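(* Let $P$ be a Markov kernel on a finite state space $S$ with $|S|=n\ge2$, reversible with respect to a stationary distribution $\pi$ of full support. Define $$g(x,y):=\frac{P(x,y)}{\pi(y)}-1,\qquad T_3(x):=\sum_{y\in S}\pi(y)\,|g(x,y)|^3.$$ Then $$I(X_0;X_1)\ge\frac12\sum_{i=2}^n\lambda_i^2-\frac16\sum_{x\in S}\pi(x)\,T_3(x).$$ If $\pi$ is uniform, then $$\bar r_\pi\ge\frac{1}{2\log n}\sum_{i=2}^n\lambda_i^2-\frac{1}{6\log n}\sum_{x\in S}\pi(x)\,T_3(x).$$
   Context: All logarithms are natural, with $0\log0=0$. $D_{\mathrm{KL}}(\mu\|\nu)=\sum_{x}\mu(x)\log\frac{\mu(x)}{\nu(x)}$. Reversible means $\pi(x)P(x,y)=\pi(y)P(y,x)$ for all $x,y$. $1=\lambda_1\ge\lambda_2\ge\cdots\ge\lambda_n\ge-1$ are the eigenvalues of $P$ in $L^2(\pi)$ (with multiplicity). $(X_0,X_1)$ is the stationary one-step pair: $X_0\sim\pi$, $X_1\mid X_0=x\sim P(x,\cdot)$, with mutual information $I(X_0;X_1):=\sum_{x,y}\pi(x)P(x,y)\log\frac{P(x,y)}{\pi(y)}$. The local KL retention ratio is $r(x):=D_{\mathrm{KL}}(P(x,\cdot)\|\pi)/\log(1/\pi(x))$ and $\bar r_\pi:=\sum_x\pi(x)r(x)$. *)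

theory Defs
  imports "HOL-Probability.Probability"
begin

text \<open>A Markov kernel on the finite state space given by the type \<open>'s\<close> is a family of
  probability mass functions; \<open>P(x,y)\<close> is \<open>pmf (P x) y\<close>.\<close>

definition stationary :: "'s pmf \<Rightarrow> ('s \<Rightarrow> 's pmf) \<Rightarrow> bool" where
  "stationary \<pi> P \<longleftrightarrow> bind_pmf \<pi> P = \<pi>"

definition reversible :: "'s pmf \<Rightarrow> ('s \<Rightarrow> 's pmf) \<Rightarrow> bool" where
  "reversible \<pi> P \<longleftrightarrow> (\<forall>x y. pmf \<pi> x * pmf (P x) y = pmf \<pi> y * pmf (P y) x)"

text \<open>If \<open>\<pi>\<close> has full support, \<open>L\<^sup>2(\<pi>)\<close> is the space of all functions on \<open>'s\<close>, here
  \<open>real ^ 's\<close>. Eigenvalues and eigenspaces do not depend on the inner product, so \<open>\<pi>\<close> does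
  not occur in their definition.\<close>

definition kernel_op :: "('s::finite \<Rightarrow> 's pmf) \<Rightarrow> real ^ 's \<Rightarrow> real ^ 's" where
  "kernel_op P f = (\<chi> x. \<Sum>y\<in>UNIV. pmf (P x) y * f $ y)"

definition eigenspace :: "('s::finite \<Rightarrow> 's pmf) \<Rightarrow> real \<Rightarrow> (real ^ 's) set" where
  "eigenspace P t = {f. kernel_op P f = t *\<^sub>R f}"

definition spectrum :: "('s::finite \<Rightarrow> 's pmf) \<Rightarrow> real set" where
  "spectrum P = {t. \<exists>f. f \<noteq> 0 \<and> f \<in> eigenspace P t}"

text \<open>The eigenvalues in decreasing order, each repeated as often as the dimension of its
  eigenspace. For a reversible kernel with \<open>\<pi>\<close> of full support the operator is self-adjoint
  on \<open>L\<^sup>2(\<pi>)\<close>, so that this list has length \<open>CARD('s)\<close>. The indexing of \<open>eigval\<close> starts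
  with 1: \<open>eigval P 1\<close> is the largest eigenvalue.\<close>

definition eigval_list :: "('s::finite \<Rightarrow> 's pmf) \<Rightarrow> real list" where
  "eigval_list P =
     concat (map (\<lambda>t. replicate (dim (eigenspace P t)) t) (rev (sorted_list_of_set (spectrum P))))"

definition eigval :: "('s::finite \<Rightarrow> 's pmf) \<Rightarrow> nat \<Rightarrow> real" where
  "eigval P i = eigval_list P ! (i - 1)"

text \<open>Since \<open>ln 0 = 0\<close>, the convention \<open>0 log 0 = 0\<close> holds in the sums below. The first sum is
  the relative entropy only if the support of \<open>\<nu>\<close> contains that of \<open>\<mu>\<close>; it is used with \<open>\<nu>\<close>
  of full support.\<close>

definition KL :: "'s::finite pmf \<Rightarrow> 's pmf \<Rightarrow> real" where
  "KL \<mu> \<nu> = (\<Sum>x\<in>UNIV. pmf \<mu> x * ln (pmf \<mu> x / pmf \<nu> x))"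

definition one_step_info :: "'s::finite pmf \<Rightarrow> ('s \<Rightarrow> 's pmf) \<Rightarrow> real" where
  "one_step_info \<pi> P =
     (\<Sum>x\<in>UNIV. \<Sum>y\<in>UNIV. pmf \<pi> x * pmf (P x) y * ln (pmf (P x) y / pmf \<pi> y))"

definition retention :: "'s::finite pmf \<Rightarrow> ('s \<Rightarrow> 's pmf) \<Rightarrow> 's \<Rightarrow> real" where
  "retention \<pi> P x = KL (P x) \<pi> / ln (1 / pmf \<pi> x)"

definition mean_retention :: "'s::finite pmf \<Rightarrow> ('s \<Rightarrow> 's pmf) \<Rightarrow> real" where
  "mean_retention \<pi> P = (\<Sum>x\<in>UNIV. pmf \<pi> x * retention \<pi> P x)"

definition centered_density :: "'s pmf \<Rightarrow> ('s \<Rightarrow> 's pmf) \<Rightarrow> 's \<Rightarrow> 's \<Rightarrow> real" where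
  "centered_density \<pi> P x y = pmf (P x) y / pmf \<pi> y - 1"

definition T3 :: "'s::finite pmf \<Rightarrow> ('s \<Rightarrow> 's pmf) \<Rightarrow> 's \<Rightarrow> real" where
  "T3 \<pi> P x = (\<Sum>y\<in>UNIV. pmf \<pi> y * \<bar>centered_density \<pi> P x y\<bar> ^ 3)"

end

theory Submission
  imports Defs
begin

text \<open>Weighting the pointwise bound \<open>(1 + g) ln (1 + g) \<ge> g + g\<^sup>2/2 - \<bar>g\<bar>\<^sup>3/6\<close>, valid for
  \<open>g \<ge> -1\<close>, by \<open>\<pi>(x) \<pi>(y)\<close> and summing over \<open>x\<close> and \<open>y\<close> kills the linear term. By
  reversibility the quadratic term is half of \<open>tr P\<^sup>2 - 1\<close>, and the spectral theorem for the
  symmetric matrix \<open>sqrt(\<pi>(x)/\<pi>(y)) P(x,y)\<close>, which is similar to \<open>P\<close>, turns this trace into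
  the sum of the squared eigenvalues, of which the largest is 1. For uniform \<open>\<pi>\<close> the mean
  retention is the mutual information divided by \<open>ln n\<close>.\<close>

section \<open>Spectral theorem for self-adjoint maps\<close>

text \<open>Induction on dimension: split off one unit eigenvector and continue in its orthogonal
  complement. Stating the result for invariant subspaces \<open>V\<close> makes the complement an
  instance of the induction hypothesis.\<close>

lemma selfadjoint_orthonormal_eigenbasis:
  fixes f :: "'a::euclidean_space \<Rightarrow> 'a"
  assumes "linear f" and sym: "\<And>x y. f x \<bullet> y = x \<bullet> f y"
  shows "subspace V \<Longrightarrow> f ` V \<subseteq> V \<Longrightarrow>
    \<exists>B l. finite B \<and> pairwise orthogonal B \<and> span B = V \<and> (\<forall>b\<in>B. norm b = 1 \<and> f b = l b *\<^sub>R b)"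
proof (induction "dim V" arbitrary: V rule: less_induct)
  case less
  interpret f: linear f by fact
  note V = less.prems(1)
  show ?case
  proof (cases "V = {0}")
    case True
    then show ?thesis by (intro exI[of _ "{}"]) auto
  next
    case False
    then obtain v where v: "v \<in> V" "v \<noteq> 0" using subspace_0[OF V] by auto
    have "compact (sphere 0 1 \<inter> V)"
      by (intro compact_Int_closed closed_subspace V) auto
    moreover have "(1 / norm v) *\<^sub>R v \<in> sphere 0 1 \<inter> V"
      using v V by (auto simp: subspace_scale)
    moreover have "continuous_on (sphere 0 1 \<inter> V) (\<lambda>x. f x \<bullet> x)"
      by (intro continuous_intros linear_continuous_on linear_conv_bounded_linear[THEN iffD1] assms)
    ultimately obtain u where u: "u \<in> V" "norm u = 1"
      and max: "\<And>x. x \<in> V \<Longrightarrow> norm x = 1 \<Longrightarrow> f x \<bullet> x \<le> f u \<bullet> u"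
      using continuous_attains_sup[of "sphere 0 1 \<inter> V" "\<lambda>x. f x \<bullet> x"]
      by (metis IntD1 IntD2 IntI empty_iff mem_sphere_0)
    define m where "m = f u \<bullet> u"
    define q where "q x = m * (x \<bullet> x) - f x \<bullet> x" for x
    have q_nonneg: "q x \<ge> 0" if "x \<in> V" for x
    proof (cases "x = 0")
      case False
      have "f ((1 / norm x) *\<^sub>R x) \<bullet> ((1 / norm x) *\<^sub>R x) \<le> m"
        unfolding m_def using False that V by (intro max) (auto simp: subspace_scale)
      then show ?thesis
        using False by (simp add: q_def f.scale field_simps power2_norm_eq_inner[symmetric] power2_eq_square)
    qed (auto simp: q_def f.zero)
    txt \<open>A maximiser \<open>u\<close> of the Rayleigh quotient is an eigenvector: the quadratic form \<open>q\<close> is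
      nonnegative on \<open>V\<close> and vanishes at \<open>u\<close>, so its first variation at \<open>u\<close> in the direction
      of the residual \<open>w\<close> is zero.\<close>
    define w where "w = f u - m *\<^sub>R u"
    have "w \<in> V"
      using u less.prems by (auto simp: w_def subspace_diff subspace_scale)
    have expand: "q (u + t *\<^sub>R w) = t\<^sup>2 * q w - 2 * t * (w \<bullet> w)" for t
    proof -
      have uu: "u \<bullet> u = 1" using u by (simp add: norm_eq_1)
      have ww: "w \<bullet> w = f u \<bullet> w - m * (u \<bullet> w)" by (subst w_def) (simp add: inner_diff_left)
      have fw: "f w \<bullet> u = f u \<bullet> w" using sym by (simp add: inner_commute)
      show ?thesis
        by (simp add: q_def ww f.add f.scale inner_add_left inner_add_right uu fw inner_commute[of w u]
            m_def[symmetric] algebra_simps power2_eq_square)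
    qed
    have "w = 0"
    proof (rule ccontr)
      assume "w \<noteq> 0"
      define s where "s = w \<bullet> w"
      have "s > 0" using \<open>w \<noteq> 0\<close> by (simp add: s_def)
      \<comment> \<open>The step is short enough that the linear term \<open>- 2 * t * s\<close>
        outweighs \<open>t\<^sup>2 * q w\<close>; the \<open>+ 1\<close> covers the case
        \<open>q w = 0\<close>.\<close>
      define t where "t = s / (q w + 1)"
      have qw: "q w \<ge> 0" using q_nonneg \<open>w \<in> V\<close> .
      have "t > 0" using \<open>s > 0\<close> qw by (simp add: t_def)
      have "t * q w \<le> s" using \<open>s > 0\<close> qw by (simp add: t_def field_simps)
      have "0 \<le> q (u + t *\<^sub>R w)"
        using u \<open>w \<in> V\<close> V by (intro q_nonneg) (auto simp: subspace_add subspace_scale)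
      also have "\<dots> = t * (t * q w - 2 * s)"
        by (simp add: expand s_def power2_eq_square algebra_simps)
      also have "\<dots> < 0"
        using \<open>t > 0\<close> \<open>t * q w \<le> s\<close> \<open>s > 0\<close> by (intro mult_pos_neg) auto
      finally show False by simp
    qed
    then have fu: "f u = m *\<^sub>R u" by (simp add: w_def)
    define W where "W = V \<inter> {x. u \<bullet> x = 0}"
    have W: "subspace W"
      unfolding W_def by (intro subspace_inter V subspace_hyperplane)
    \<comment> \<open>For \<open>x\<close> in \<open>W\<close>, symmetry gives
      \<open>u \<bullet> f x = f u \<bullet> x = m * (u \<bullet> x) = 0\<close>.\<close>
    have "f ` W \<subseteq> W"
      using less.prems(2) by (auto simp: W_def sym[symmetric] fu)
    moreover have "dim W < dim V"
    proof (rule dim_psubset)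
      have "u \<notin> W" using u by (auto simp: W_def)
      then show "span W \<subset> span V"
        using u unfolding span_eq_iff[THEN iffD2, OF W] span_eq_iff[THEN iffD2, OF V]
        by (metis Int_lower1 W_def psubsetI)
    qed
    ultimately obtain B l where B: "finite B" "pairwise orthogonal B" "span B = W"
      and eig: "\<And>b. b \<in> B \<Longrightarrow> norm b = 1 \<and> f b = l b *\<^sub>R b"
      using less.hyps W by metis
    have BW: "B \<subseteq> W" using B(3) span_superset by blast
    \<comment> \<open>This makes the override \<open>l(u := m)\<close> below harmless for the
      eigenvalues already assigned on \<open>B\<close>.\<close>
    then have "u \<notin> B" using u by (auto simp: W_def)
    have "span (insert u B) = V"
    proof
      have "W \<subseteq> V" by (auto simp: W_def)
      then show "span (insert u B) \<subseteq> V"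
        using u BW V by (intro span_minimal) auto
      show "V \<subseteq> span (insert u B)"
      proof
        fix x assume "x \<in> V"
        then have "x - (u \<bullet> x) *\<^sub>R u \<in> span B"
          using u V by (auto simp: B W_def subspace_diff subspace_scale inner_diff_right norm_eq_1)
        then show "x \<in> span (insert u B)"
          using span_breakdown_eq by blast
      qed
    qed
    moreover have "pairwise orthogonal (insert u B)"
      using B BW by (auto simp: pairwise_insert W_def orthogonal_def inner_commute)
    ultimately show ?thesis
      using B eig u fu \<open>u \<notin> B\<close>
      by (intro exI[of _ "insert u B"] exI[of _ "l(u := m)"]) auto
  qed
qed

section \<open>Pointwise cubic bound for the entropy density\<close>

text \<open>On either side of 0 the difference of the two sides vanishes at 0 and is monotone away
  from it, by the sign of its derivative.\<close>

lemma entropy_density_lower_bound: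
  fixes g :: real
  assumes "g \<ge> -1"
  shows "(1 + g) * ln (1 + g) \<ge> g + g\<^sup>2 / 2 - \<bar>g\<bar> ^ 3 / 6"
proof -
  \<comment> \<open>The endpoint is separate because \<open>ln (1 + g)\<close> is not differentiable
    there; the left side is then 0 and the right side -2/3.\<close>
  consider "g = -1" | "-1 < g" "g < 0" | "g \<ge> 0" using assms by linarith
  then show ?thesis
  proof cases
    case 2
    let ?h = "\<lambda>g::real. (1 + g) * ln (1 + g) - g - g\<^sup>2 / 2 - g ^ 3 / 6"
    have "?h 0 \<le> ?h g"
    proof (rule DERIV_nonpos_imp_nonincreasing[of g 0 ?h])
      fix x assume "g \<le> x" "x \<le> 0"
      then have "x > -1" using 2 by simp
      then have "(?h has_real_derivative ln (1 + x) - x - x\<^sup>2 / 2) (at x)"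
        by (auto intro!: derivative_eq_intros simp: divide_simps)
      moreover have "ln (1 + x) - x - x\<^sup>2 / 2 \<le> 0"
        using ln_add_one_self_le_self2[of x] \<open>x > -1\<close> zero_le_power2[of x] by linarith
      ultimately show "\<exists>y. (?h has_real_derivative y) (at x) \<and> y \<le> 0"
        by blast
    qed (use 2 in auto)
    then show ?thesis using 2 by (simp add: power3_eq_cube)
  next
    case 3
    let ?h = "\<lambda>g::real. (1 + g) * ln (1 + g) - g - g\<^sup>2 / 2 + g ^ 3 / 6"
    have "?h 0 \<le> ?h g"
    proof (rule DERIV_nonneg_imp_nondecreasing[of 0 g ?h])
      fix x assume "0 \<le> x" "x \<le> g"
      then have "(?h has_real_derivative ln (1 + x) - x + x\<^sup>2 / 2) (at x)"
        by (auto intro!: derivative_eq_intros simp: divide_simps)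
      moreover have "ln (1 + x) - x + x\<^sup>2 / 2 \<ge> 0"
      proof -
        \<comment> \<open>The sign of the derivative needs a second monotonicity argument: it
          vanishes at 0 and its own derivative is \<open>z\<^sup>2 / (1 + z)\<close>.\<close>
        have "ln (1 + 0) - 0 + 0\<^sup>2 / 2 \<le> ln (1 + x) - x + x\<^sup>2 / 2"
        proof (rule DERIV_nonneg_imp_nondecreasing[of 0 x "\<lambda>x. ln (1 + x) - x + x\<^sup>2 / 2"])
          fix z assume "0 \<le> z" "z \<le> x"
          then have "((\<lambda>x. ln (1 + x) - x + x\<^sup>2 / 2) has_real_derivative z\<^sup>2 / (1 + z)) (at z)"
            by (auto intro!: derivative_eq_intros simp: field_simps power2_eq_square)
          then show "\<exists>y. ((\<lambda>x. ln (1 + x) - x + x\<^sup>2 / 2) has_real_derivative y) (at z) \<and> y \<ge> 0"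
            using \<open>0 \<le> z\<close> by fastforce
        qed (use \<open>0 \<le> x\<close> in auto)
        then show ?thesis by simp
      qed
      ultimately show "\<exists>y. (?h has_real_derivative y) (at x) \<and> y \<ge> 0"
        by blast
    qed (use 3 in auto)
    then show ?thesis using 3 by (simp add: power3_eq_cube)
  qed auto
qed


section \<open>Multiplicities and the Hilbert-Schmidt norm\<close>

text \<open>In an orthonormal eigenbasis \<open>B\<close> with eigenvalues \<open>l\<close>, the
  dimension of \<open>E t\<close> counts the basis vectors labelled \<open>t\<close>. The last
  identity computes the squared Hilbert-Schmidt norm in \<open>B\<close> and in the standard
  basis.\<close>

lemma selfadjoint_spectral_sums:
  fixes f :: "'a::euclidean_space \<Rightarrow> 'a"
  assumes "linear f" and sym: "\<And>x y. f x \<bullet> y = x \<bullet> f y"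
  defines "E \<equiv> \<lambda>t. {x. f x = t *\<^sub>R x}" and "\<Sigma> \<equiv> {t. \<exists>x. x \<noteq> 0 \<and> f x = t *\<^sub>R x}"
  shows "finite \<Sigma>"
    and "(\<Sum>t\<in>\<Sigma>. dim (E t)) = DIM('a)"
    and "(\<Sum>t\<in>\<Sigma>. real (dim (E t)) * t\<^sup>2) = (\<Sum>i\<in>Basis. (norm (f i))\<^sup>2)"
proof -
  interpret f: linear f by fact
  obtain B l where B: "finite B" "pairwise orthogonal B" "span B = UNIV"
    and norm_B: "\<And>b. b \<in> B \<Longrightarrow> norm b = 1" and eig: "\<And>b. b \<in> B \<Longrightarrow> f b = l b *\<^sub>R b"
    using selfadjoint_orthonormal_eigenbasis[OF assms(1,2) subspace_UNIV] by auto
  have "0 \<notin> B" using norm_B by force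
  then have indep: "independent B" using B pairwise_orthogonal_independent by blast
  have inner_B: "b \<bullet> c = (if b = c then 1 else 0)" if "b \<in> B" "c \<in> B" for b c
    using that B(2) norm_B by (auto simp: pairwise_def orthogonal_def norm_eq_1)
  have expand: "x = (\<Sum>b\<in>B. (x \<bullet> b) *\<^sub>R b)" for x
  proof -
    obtain u where u: "x = (\<Sum>b\<in>B. u b *\<^sub>R b)"
      using B span_finite[OF B(1)] by (metis (no_types, lifting) UNIV_I imageE)
    have "x \<bullet> c = u c" if "c \<in> B" for c
    proof -
      have "x \<bullet> c = (\<Sum>b\<in>B. if b = c then u b else 0)"
        using that by (auto simp: u inner_sum_left inner_B intro!: sum.cong)
      then show ?thesis using that B(1) by simp
    qed
    then show ?thesis using u by simp
  qed
  have parseval: "(norm x)\<^sup>2 = (\<Sum>b\<in>B. (x \<bullet> b)\<^sup>2)" for x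
  proof -
    have "(norm x)\<^sup>2 = x \<bullet> (\<Sum>b\<in>B. (x \<bullet> b) *\<^sub>R b)"
      using expand[of x] by (simp add: power2_norm_eq_inner)
    then show ?thesis by (simp add: inner_sum_right power2_eq_square)
  qed
  have E_span: "E t = span {b \<in> B. l b = t}" for t
  proof
    have "subspace (E t)"
      by (auto simp: E_def subspace_def f.add f.scale scaleR_add_right)
    then show "span {b \<in> B. l b = t} \<subseteq> E t"
      by (intro span_minimal) (auto simp: E_def eig)
    show "E t \<subseteq> span {b \<in> B. l b = t}"
    proof
      fix x assume "x \<in> E t"
      \<comment> \<open>Eigenvectors of distinct eigenvalues are orthogonal: symmetry gives
        \<open>t * (x \<bullet> b) = l b * (x \<bullet> b)\<close>.\<close>
      have "x \<bullet> b = 0" if "b \<in> B" "l b \<noteq> t" for b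
        using sym[of x b] that \<open>x \<in> E t\<close> by (simp add: E_def eig)
      then have "(\<Sum>b\<in>B. (x \<bullet> b) *\<^sub>R b) \<in> span {b \<in> B. l b = t}"
        by (intro span_sum)
          (metis (mono_tags, lifting) mem_Collect_eq scaleR_eq_0_iff span_base span_scale span_zero)
      then show "x \<in> span {b \<in> B. l b = t}" using expand[of x] by simp
    qed
  qed
  have dim_E: "dim (E t) = card {b \<in> B. l b = t}" for t
    unfolding E_span using independent_mono[OF indep]
    by (subst dim_span) (auto intro: dim_eq_card_independent)
  have \<Sigma>: "\<Sigma> = l ` B"
  proof
    have "l b \<in> \<Sigma>" if "b \<in> B" for b
      unfolding \<Sigma>_def mem_Collect_eq using that \<open>0 \<notin> B\<close> by (intro exI[of _ b] conjI eig) auto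
    then show "l ` B \<subseteq> \<Sigma>" by auto
    show "\<Sigma> \<subseteq> l ` B"
    proof
      fix t assume "t \<in> \<Sigma>"
      then obtain x where "x \<noteq> 0" "x \<in> E t" by (auto simp: \<Sigma>_def E_def)
      then have "{b \<in> B. l b = t} \<noteq> {}" unfolding E_span by (metis singletonD span_empty)
      then show "t \<in> l ` B" by auto
    qed
  qed
  show "finite \<Sigma>" using B by (simp add: \<Sigma>)
  have "(\<Sum>t\<in>\<Sigma>. dim (E t)) = card B"
    unfolding \<Sigma> dim_E card_eq_sum by (rule sum.image_gen[OF B(1), symmetric])
  also have "card B = DIM('a)"
    using dim_eq_card_independent[OF indep] dim_span[of B] B(3) by simp
  finally show "(\<Sum>t\<in>\<Sigma>. dim (E t)) = DIM('a)" .
  have "(\<Sum>t\<in>\<Sigma>. real (dim (E t)) * t\<^sup>2) = (\<Sum>b\<in>B. (l b)\<^sup>2)"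
    by (subst sum.image_gen[OF B(1), of _ l]) (simp add: \<Sigma> dim_E)
  also have "\<dots> = (\<Sum>b\<in>B. (norm (f b))\<^sup>2)"
    by (intro sum.cong) (auto simp: eig norm_B)
  \<comment> \<open>Change of basis: expand \<open>f b\<close> in the standard basis, move
    \<open>f\<close> across by symmetry, swap the sums, and collapse the sum over \<open>B\<close>
    by Parseval.\<close>
  also have "\<dots> = (\<Sum>b\<in>B. \<Sum>i\<in>Basis. (f b \<bullet> i)\<^sup>2)"
    unfolding power2_norm_eq_inner by (subst euclidean_inner) (simp add: power2_eq_square)
  also have "\<dots> = (\<Sum>i\<in>Basis. \<Sum>b\<in>B. (f i \<bullet> b)\<^sup>2)"
    by (subst sum.swap, intro sum.cong refl) (metis sym inner_commute)
  also have "\<dots> = (\<Sum>i\<in>Basis. (norm (f i))\<^sup>2)"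
    by (simp add: parseval)
  finally show "(\<Sum>t\<in>\<Sigma>. real (dim (E t)) * t\<^sup>2) = (\<Sum>i\<in>Basis. (norm (f i))\<^sup>2)" .
qed

section \<open>Transfer to reversible kernels\<close>

text \<open>Division by \<open>sqrt (pmf \<pi> x)\<close>, the map \<open>c\<close>, is an isometry
  from Euclidean space onto \<open>L\<^sup>2(\<pi>)\<close>. It conjugates the kernel operator to
  the symmetric matrix \<open>a\<close>, so both have the same eigenvalues with
  multiplicity.\<close>

lemma reversible_spectral_sums:
  fixes P :: "'s::finite \<Rightarrow> 's pmf"
  assumes rev: "reversible \<pi> P" and "set_pmf \<pi> = UNIV"
  shows finite_spectrum: "finite (spectrum P)"
    and sum_dim_eigenspace: "(\<Sum>t\<in>spectrum P. dim (eigenspace P t)) = CARD('s)"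
    and sum_dim_eigenspace_sq: "(\<Sum>t\<in>spectrum P. real (dim (eigenspace P t)) * t\<^sup>2) =
      (\<Sum>x\<in>UNIV. \<Sum>y\<in>UNIV. pmf \<pi> x * (pmf (P x) y)\<^sup>2 / pmf \<pi> y)"
proof -
  have pos: "pmf \<pi> x > 0" for x
    using assms(2) pmf_positive[of x \<pi>] by simp
  define s where "s x = sqrt (pmf \<pi> x)" for x
  have s: "s x > 0" "s x * s x = pmf \<pi> x" for x
    using pos by (simp_all add: s_def less_imp_le)
  define a where "a x y = s x * pmf (P x) y / s y" for x y
  \<comment> \<open>After cross-multiplication this is detailed balance, since
    \<open>s x * s x = pmf \<pi> x\<close>.\<close>
  have a_sym: "a x y = a y x" for x y
    using rev s[of x] s[of y] unfolding reversible_def a_def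
    by (metis (no_types, opaque_lifting) frac_eq_eq less_irrefl mult.assoc mult.commute)
  define f where "f v = (\<chi> x. \<Sum>y\<in>UNIV. a x y * v $ y)" for v :: "real ^ 's"
  define c where "c v = (\<chi> x. v $ x / s x)" for v :: "real ^ 's"
  have "linear f"
    by (rule linearI) (auto simp: f_def vec_eq_iff sum.distrib sum_distrib_left algebra_simps)
  have f_sym: "f v \<bullet> w = v \<bullet> f w" for v w
  proof -
    have "f v \<bullet> w = (\<Sum>x\<in>UNIV. \<Sum>y\<in>UNIV. a x y * v $ y * w $ x)"
      by (simp add: f_def inner_vec_def sum_distrib_right)
    also have "\<dots> = (\<Sum>y\<in>UNIV. \<Sum>x\<in>UNIV. a y x * v $ y * w $ x)"
      by (subst sum.swap) (simp add: a_sym)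
    also have "\<dots> = v \<bullet> f w"
      by (simp add: f_def inner_vec_def sum_distrib_left mult_ac)
    finally show ?thesis .
  qed
  have "linear c"
    by (rule linearI) (auto simp: c_def vec_eq_iff add_divide_distrib)
  have c_inv: "c (\<chi> x. v $ x * s x) = v" for v
    using s by (simp add: c_def vec_eq_iff less_imp_neq[symmetric])
  have "inj c"
  proof (rule injI)
    fix v w assume "c v = c w"
    then have "v $ x / s x = w $ x / s x" for x by (simp add: c_def vec_eq_iff)
    then show "v = w" using s(1) by (simp add: vec_eq_iff) (metis less_irrefl)
  qed
  have conj: "kernel_op P (c v) = c (f v)" for v
    using s(1) by (auto simp: kernel_op_def c_def f_def a_def vec_eq_iff sum_divide_distrib
        less_imp_neq[symmetric] intro!: sum.cong)
  have eig_iff: "c v \<in> eigenspace P t \<longleftrightarrow> f v = t *\<^sub>R v" for v t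
    using \<open>inj c\<close> linear_scale[OF \<open>linear c\<close>, of t v]
    by (auto simp: eigenspace_def conj inj_def)
  have eigenspace: "eigenspace P t = c ` {v. f v = t *\<^sub>R v}" for t
    using eig_iff c_inv by (auto simp: image_iff) (metis c_inv eig_iff)
  have dim: "dim (eigenspace P t) = dim {v. f v = t *\<^sub>R v}" for t
    unfolding eigenspace using \<open>linear c\<close> \<open>inj c\<close>
    by (intro dim_image_eq) (auto intro: inj_on_subset)
  have "c v = 0 \<longleftrightarrow> v = 0" for v
    using \<open>inj c\<close> linear_0[OF \<open>linear c\<close>] by (metis injD)
  then have spectrum: "spectrum P = {t. \<exists>v. v \<noteq> 0 \<and> f v = t *\<^sub>R v}"
    unfolding spectrum_def eigenspace by auto
  note sums = selfadjoint_spectral_sums[OF \<open>linear f\<close> f_sym, folded spectrum dim]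
  show "finite (spectrum P)" by (rule sums)
  show "(\<Sum>t\<in>spectrum P. dim (eigenspace P t)) = CARD('s)" using sums(2) by simp
  have "f (axis y 1) = (\<chi> x. a x y)" for y
    by (simp add: f_def axis_def if_distrib cong: if_cong)
  then have norm_f: "(norm (f (axis y 1)))\<^sup>2 = (\<Sum>x\<in>UNIV. (a x y)\<^sup>2)" for y
    unfolding power2_norm_eq_inner by (simp add: inner_vec_def power2_eq_square)
  \<comment> \<open>The standard basis consists of the vectors \<open>axis y 1\<close>, which
    \<open>f\<close> sends to the columns of \<open>a\<close>; the sum is the squared Frobenius norm
    of \<open>a\<close>.\<close>
  have "(\<Sum>i\<in>Basis. (norm (f i))\<^sup>2) = (\<Sum>y\<in>UNIV. (norm (f (axis y 1)))\<^sup>2)"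
    by (subst sum.reindex[symmetric, of "\<lambda>y. axis y (1::real)", unfolded o_def])
       (auto simp: inj_def axis_eq_axis Basis_vec_def intro!: sum.cong)
  also have "\<dots> = (\<Sum>y\<in>UNIV. \<Sum>x\<in>UNIV. (a x y)\<^sup>2)"
    by (simp add: norm_f)
  also have "\<dots> = (\<Sum>y\<in>UNIV. \<Sum>x\<in>UNIV. pmf \<pi> x * (pmf (P x) y)\<^sup>2 / pmf \<pi> y)"
    by (simp add: a_def power_mult_distrib power_divide s(2)[folded power2_eq_square])
  also have "\<dots> = (\<Sum>x\<in>UNIV. \<Sum>y\<in>UNIV. pmf \<pi> x * (pmf (P x) y)\<^sup>2 / pmf \<pi> y)"
    by (rule sum.swap)
  finally show "(\<Sum>t\<in>spectrum P. real (dim (eigenspace P t)) * t\<^sup>2) =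
      (\<Sum>x\<in>UNIV. \<Sum>y\<in>UNIV. pmf \<pi> x * (pmf (P x) y)\<^sup>2 / pmf \<pi> y)"
    using sums(3) by simp
qed

section \<open>The ordered eigenvalue list and its top entry\<close>

lemma sum_pmf_finite_type: "(\<Sum>x\<in>UNIV. pmf (p :: 's::finite pmf) x) = 1"
  by (rule sum_pmf_eq_1) auto

text \<open>Each row of \<open>P\<close> sums to 1, so constant functions are fixed.\<close>

lemma one_in_spectrum: "1 \<in> spectrum P"
proof -
  have "(\<chi> x. 1) \<noteq> (0 :: real ^ 'a)" by (simp add: vec_eq_iff)
  moreover have "(\<chi> x. 1) \<in> eigenspace P 1"
    by (simp add: eigenspace_def kernel_op_def vec_eq_iff sum_pmf_finite_type)
  ultimately show ?thesis unfolding spectrum_def by blast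
qed

lemma spectrum_le_1:
  assumes "t \<in> spectrum P"
  shows "t \<le> 1"
proof -
  obtain f where f: "f \<noteq> 0" and eig: "\<And>x. (\<Sum>y\<in>UNIV. pmf (P x) y * f $ y) = t * f $ x"
    using assms by (auto simp: spectrum_def eigenspace_def kernel_op_def vec_eq_iff)
  txt \<open>Maximum principle at a point where \<open>\<bar>f\<bar>\<close> is largest.\<close>
  define M where "M = Max (range (\<lambda>x. \<bar>f $ x\<bar>))"
  have M: "\<bar>f $ x\<bar> \<le> M" for x by (simp add: M_def)
  have "M \<in> range (\<lambda>x. \<bar>f $ x\<bar>)" unfolding M_def by (intro Max_in) auto
  then obtain x where x: "M = \<bar>f $ x\<bar>" by auto
  obtain z where "f $ z \<noteq> 0" using f by (auto simp: vec_eq_iff)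
  then have "M > 0" using M[of z] by linarith
  have "\<bar>t\<bar> * M = \<bar>\<Sum>y\<in>UNIV. pmf (P x) y * f $ y\<bar>" by (simp add: eig x abs_mult)
  also have "\<dots> \<le> (\<Sum>y\<in>UNIV. pmf (P x) y * M)"
    by (intro order.trans[OF sum_abs] sum_mono) (simp add: abs_mult mult_left_mono M)
  also have "\<dots> = M" by (simp add: sum_distrib_right[symmetric] sum_pmf_finite_type)
  finally show ?thesis using \<open>M > 0\<close> by (simp add: abs_le_iff)
qed

text \<open>Identifies the term omitted by sums starting at \<open>i = 2\<close>: the list is
  decreasing and 1 is the largest eigenvalue. The tail may contain further entries 1.\<close>

lemma eigval_list_Cons:
  assumes "finite (spectrum P)"
  shows "eigval_list P = 1 # tl (eigval_list P)"
proof -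
  let ?ts = "rev (sorted_list_of_set (spectrum P))"
  have set: "set ?ts = spectrum P" using assms by simp
  then obtain t ts where ts: "?ts = t # ts"
    using one_in_spectrum[of P] by (metis list.exhaust list.set(1) empty_iff)
  have "sorted_wrt (\<ge>) (t # ts)" unfolding ts[symmetric] sorted_wrt_rev by simp
  then have "t \<ge> 1" using one_in_spectrum[of P] set unfolding ts by auto
  moreover have "t \<le> 1" using spectrum_le_1[of t P] set unfolding ts by auto
  ultimately have "t = 1" by simp
  \<comment> \<open>The block \<open>replicate (dim (eigenspace P 1)) 1\<close> must be nonempty for
    the list to start with 1.\<close>
  have "dim (eigenspace P 1) \<noteq> 0"
    using one_in_spectrum[of P] by (auto simp: spectrum_def)
  then obtain k where "dim (eigenspace P 1) = Suc k" using not0_implies_Suc by blast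
  then show ?thesis by (simp add: eigval_list_def ts \<open>t = 1\<close>)
qed

lemma length_eigval_list:
  assumes "finite (spectrum P)"
  shows "length (eigval_list P) = (\<Sum>t\<in>spectrum P. dim (eigenspace P t))"
  using assms
  by (simp add: eigval_list_def length_concat rev_map[symmetric] o_def sum_list_distinct_conv_sum_set)

lemma sum_list_eigval_list:
  assumes "finite (spectrum P)"
  shows "(\<Sum>t\<leftarrow>eigval_list P. h t) = (\<Sum>t\<in>spectrum P. real (dim (eigenspace P t)) * h t)"
proof -
  have "(\<Sum>t\<leftarrow>concat (map (\<lambda>t. replicate (n t) t) ts). h t) = (\<Sum>t\<leftarrow>ts. real (n t) * h t)" for n ts
    by (induction ts) (auto simp: sum_list_replicate)
  then show ?thesis
    using assms by (simp add: eigval_list_def sum_list_distinct_conv_sum_set)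
qed

text \<open>By detailed balance each summand on the right equals
  \<open>pmf (P x) y * pmf (P y) x\<close>, so the double sum is the trace of the squared kernel;
  the 1 subtracted is the square of the top eigenvalue.\<close>

lemma sum_eigval_sq:
  fixes P :: "'s::finite \<Rightarrow> 's pmf"
  assumes "reversible \<pi> P" and "set_pmf \<pi> = UNIV"
  shows "(\<Sum>i = 2..CARD('s). (eigval P i)\<^sup>2) =
    (\<Sum>x\<in>UNIV. \<Sum>y\<in>UNIV. pmf \<pi> x * (pmf (P x) y)\<^sup>2 / pmf \<pi> y) - 1"
proof -
  note fin = finite_spectrum[OF assms]
  define L where "L = tl (eigval_list P)"
  have L: "eigval_list P = 1 # L" using eigval_list_Cons[OF fin] by (simp add: L_def)
  have "Suc (length L) = CARD('s)"
    using length_eigval_list[OF fin] by (simp add: L sum_dim_eigenspace[OF assms])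
  \<comment> \<open>\<open>eigval P i\<close> is entry \<open>i - 1\<close> of \<open>1 # L\<close>,
    hence entry \<open>i - 2\<close> of \<open>L\<close> for \<open>i \<ge> 2\<close>; the range 2
    to \<open>CARD('s)\<close> covers exactly \<open>L\<close>.\<close>
  then have "(\<Sum>i = 2..CARD('s). (eigval P i)\<^sup>2) = (\<Sum>i = 0 + 2..<length L + 2. (eigval P i)\<^sup>2)"
    by (intro sum.cong) auto
  also have "\<dots> = (\<Sum>i<length L. (L ! i)\<^sup>2)"
    by (subst sum.shift_bounds_nat_ivl) (simp add: eigval_def L atLeast0LessThan)
  also have "\<dots> = (\<Sum>t\<leftarrow>eigval_list P. t\<^sup>2) - 1"
    by (simp add: L sum_list_sum_nth[of "map _ L"] atLeast0LessThan)
  finally show ?thesis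
    by (simp add: sum_list_eigval_list[OF fin] sum_dim_eigenspace_sq[OF assms])
qed

section \<open>Bounds for mutual information and mean retention\<close>

theorem theorem5p4:
  fixes P :: "'s::finite \<Rightarrow> 's pmf" and \<pi> :: "'s pmf"
  assumes "CARD('s) \<ge> 2"
    and "stationary \<pi> P"
    and "reversible \<pi> P"
    and "set_pmf \<pi> = UNIV"
  shows "one_step_info \<pi> P \<ge>
           1 / 2 * (\<Sum>i = 2..CARD('s). (eigval P i)\<^sup>2)
           - 1 / 6 * (\<Sum>x\<in>UNIV. pmf \<pi> x * T3 \<pi> P x)
       \<and> (\<pi> = pmf_of_set UNIV \<longrightarrow>
           mean_retention \<pi> P \<ge>
             1 / (2 * ln (real CARD('s))) * (\<Sum>i = 2..CARD('s). (eigval P i)\<^sup>2)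
             - 1 / (6 * ln (real CARD('s))) * (\<Sum>x\<in>UNIV. pmf \<pi> x * T3 \<pi> P x))"
proof -
  have pos: "pmf \<pi> x > 0" for x
    using assms(4) pmf_positive[of x \<pi>] by simp
  let ?A = "\<Sum>i = 2..CARD('s). (eigval P i)\<^sup>2"
  let ?T = "\<Sum>x\<in>UNIV. pmf \<pi> x * T3 \<pi> P x"
  let ?g = "centered_density \<pi> P"
  \<comment> \<open>The identity \<open>g + g\<^sup>2 / 2 = ((1 + g)\<^sup>2 - 1) / 2\<close>
    absorbs the linear term and produces the summand of \<open>sum_eigval_sq\<close>
    directly.\<close>
  have pointwise: "pmf \<pi> x * (pmf (P x) y * ln (pmf (P x) y / pmf \<pi> y)) \<ge>
      1 / 2 * (pmf \<pi> x * (pmf (P x) y)\<^sup>2 / pmf \<pi> y) - 1 / 2 * (pmf \<pi> x * pmf \<pi> y)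
      - 1 / 6 * (pmf \<pi> x * (pmf \<pi> y * \<bar>?g x y\<bar> ^ 3))" for x y
  proof -
    have ratio: "pmf (P x) y / pmf \<pi> y = 1 + ?g x y"
      by (simp add: centered_density_def)
    then have P: "pmf (P x) y = pmf \<pi> y * (1 + ?g x y)"
      using pos[of y] by (simp add: field_simps)
    have sq: "pmf \<pi> x * (pmf (P x) y)\<^sup>2 / pmf \<pi> y = pmf \<pi> x * pmf \<pi> y * (1 + ?g x y)\<^sup>2"
      unfolding P using pos[of y] by (simp add: power2_eq_square)
    have "pmf \<pi> y * (1 + ?g x y) \<ge> 0" unfolding P[symmetric] by simp
    then have "?g x y \<ge> -1" using pos[of y] by (simp add: zero_le_mult_iff)
    then have "pmf \<pi> x * pmf \<pi> y * (?g x y + (?g x y)\<^sup>2 / 2 - \<bar>?g x y\<bar> ^ 3 / 6)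
      \<le> pmf \<pi> x * pmf \<pi> y * ((1 + ?g x y) * ln (1 + ?g x y))"
      by (intro mult_left_mono entropy_density_lower_bound) auto
    then show ?thesis
      unfolding ratio sq unfolding P by (simp add: algebra_simps power2_eq_square)
  qed
  \<comment> \<open>The products \<open>pmf \<pi> x * pmf \<pi> y\<close> sum to 1, which accounts
    for the \<open>- 1\<close> in \<open>sum_eigval_sq\<close>.\<close>
  have "1 / 2 * ?A - 1 / 6 * ?T =
    (\<Sum>x\<in>UNIV. \<Sum>y\<in>UNIV. 1 / 2 * (pmf \<pi> x * (pmf (P x) y)\<^sup>2 / pmf \<pi> y) - 1 / 2 * (pmf \<pi> x * pmf \<pi> y)
      - 1 / 6 * (pmf \<pi> x * (pmf \<pi> y * \<bar>?g x y\<bar> ^ 3)))"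
    unfolding sum_subtractf sum_distrib_left[symmetric] T3_def[symmetric]
    by (simp add: sum_eigval_sq[OF assms(3,4)] sum_pmf_finite_type)
  also have "\<dots> \<le> one_step_info \<pi> P"
    unfolding one_step_info_def mult.assoc by (intro sum_mono pointwise)
  finally have info: "one_step_info \<pi> P \<ge> 1 / 2 * ?A - 1 / 6 * ?T" .
  moreover have "mean_retention \<pi> P \<ge>
      1 / (2 * ln (real CARD('s))) * ?A - 1 / (6 * ln (real CARD('s))) * ?T"
    if unif: "\<pi> = pmf_of_set UNIV"
  proof -
    define c where "c = ln (real CARD('s))"
    have "c > 0" using assms(1) by (simp add: c_def)
    \<comment> \<open>Uniformity makes the normaliser of the retention ratio independent of
      \<open>x\<close>, so it factors out of the mean.\<close>
    have "ln (1 / pmf \<pi> x) = c" for x by (simp add: unif c_def)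
    then have "mean_retention \<pi> P = one_step_info \<pi> P / c"
      by (simp add: mean_retention_def retention_def one_step_info_def KL_def
          sum_divide_distrib sum_distrib_left mult.assoc)
    also have "\<dots> \<ge> (1 / 2 * ?A - 1 / 6 * ?T) / c"
      using info \<open>c > 0\<close> by (intro divide_right_mono) auto
    finally show ?thesis
      using \<open>c > 0\<close> by (simp add: c_def[symmetric] diff_divide_distrib)
  qed
  ultimately show ?thesis by blast
qed

end
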